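(* Let $n,m$ be positive integers such that $n>m>1$. Let $k=n-m$. Let $c$ be a positive integer such that $n=cx$ and $m=cy$ for positive integers $x,y$. If either (i) $c>1$ and $k+1\leq x$, or (ii) $d=\frac{n}{k+1}>1$ and $d$ is an integer, then there exists a bipartite graph $G=(U,V;E)$ with $|U|=n$ and $|V|=m$ such that $\deg(u)\in\left\{\left\lfloor\frac{m(k+1)}{n}\right\rfloor,\left\lceil\frac{m(k+1)}{n}\right\rceil\right\}$ for any $u\in U$ and $\deg(v)=k+1$ for any $v\in V$, which is not $k$-critical-bipartite.
   Context: All graphs are finite, simple and undirected. $G=(U,V;E)$ denotes a bipartite graph with color classes $U,V$ and edge set $E$. A bipartite graph $G=(U,V;E)$ with $k=|U|-|V|\ge 0$ is $k$-critical-bipartite if, after deleting any $k$ vertices from $U$, the remaining subgraph has a perfect matching. *)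

theory Defs
  imports Complex_Main
begin

text \<open>A finite simple undirected bipartite graph with colour classes \<open>U\<close> and \<open>V\<close>; an edge is
  the two-element set of its ends.\<close>

definition bipartite_graph :: "'a set \<Rightarrow> 'a set \<Rightarrow> 'a set set \<Rightarrow> bool" where
  "bipartite_graph U V E \<longleftrightarrow>
     finite U \<and> finite V \<and> U \<inter> V = {} \<and> E \<subseteq> {{u, v} | u v. u \<in> U \<and> v \<in> V}"

definition degree :: "'a set set \<Rightarrow> 'a \<Rightarrow> nat" where
  "degree E w = card {e \<in> E. w \<in> e}"

definition matching :: "'a set set \<Rightarrow> 'a set set \<Rightarrow> bool" where
  "matching E M \<longleftrightarrow> M \<subseteq> E \<and> (\<forall>e\<in>M. \<forall>f\<in>M. e \<noteq> f \<longrightarrow> e \<inter> f = {})"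

definition has_perfect_matching :: "'a set \<Rightarrow> 'a set set \<Rightarrow> bool" where
  "has_perfect_matching W E \<longleftrightarrow> (\<exists>M. matching E M \<and> \<Union> M = W)"

definition delete_vertices :: "'a set set \<Rightarrow> 'a set \<Rightarrow> 'a set set" where
  "delete_vertices E S = {e \<in> E. e \<inter> S = {}}"

definition critical_bipartite :: "nat \<Rightarrow> 'a set \<Rightarrow> 'a set \<Rightarrow> 'a set set \<Rightarrow> bool" where
  "critical_bipartite k U V E \<longleftrightarrow>
     bipartite_graph U V E \<and> card U = card V + k \<and>
     (\<forall>S. S \<subseteq> U \<and> card S = k \<longrightarrow>
        has_perfect_matching ((U - S) \<union> V) (delete_vertices E S))"

end

(* Both graphs violate Hall's condition after deleting k vertices. In case (i) take c disjoint
   copies of an almost biregular graph with classes of sizes x and y, in which the neighbourhoods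
   are consecutive cyclic intervals of length k + 1; since x - y = k/c < k, deleting k vertices of
   U inside one copy leaves fewer than y of them there. In case (ii) split U into d blocks of size
   k + 1, join each v to a whole block and distribute the v evenly; since m > d, some block serves
   two vertices of V, and deleting k of its k + 1 vertices leaves them a single neighbour. *)
theory Submission
  imports Defs
begin

section \<open>Sizes of residue classes in an initial segment\<close>

lemma mem_floor_ceiling_if_abs_diff_less_1:
  fixes r :: real
  assumes "\<bar>of_int p - r\<bar> < 1"
  shows "p \<in> {\<lfloor>r\<rfloor>, \<lceil>r\<rceil>}"
  using assms by (simp, linarith)

text \<open>The members are \<open>a + x * q\<close>, and \<open>a + x * q < N\<close> amounts to
  \<open>(q + 1) * x \<le> N + (x - 1 - a)\<close>, so \<open>q\<close> runs exactly through the
  numbers below the quotient.\<close>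

lemma card_residue_class:
  fixes a x N :: nat
  assumes "a < x"
  shows "card {t. t < N \<and> t mod x = a} = (N + (x - 1 - a)) div x"
proof -
  have "{t. t < N \<and> t mod x = a} = (\<lambda>q. a + x * q) ` {..<(N + (x - 1 - a)) div x}"
  proof (intro equalityI subsetI)
    fix t assume t: "t \<in> {t. t < N \<and> t mod x = a}"
    then have eq: "t = a + x * (t div x)"
      using mod_mult_div_eq[of t x] by simp
    have "t < N" using t by simp
    with eq assms have "x + x * (t div x) \<le> N + (x - 1 - a)"
      by linarith
    then have "Suc (t div x) * x \<le> N + (x - 1 - a)"
      by (simp add: mult.commute)
    then have "Suc (t div x) \<le> (N + (x - 1 - a)) div x"
      using assms by (simp add: less_eq_div_iff_mult_less_eq)
    with eq show "t \<in> (\<lambda>q. a + x * q) ` {..<(N + (x - 1 - a)) div x}"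
      by auto
  next
    fix t assume "t \<in> (\<lambda>q. a + x * q) ` {..<(N + (x - 1 - a)) div x}"
    then obtain q where q: "t = a + x * q" "Suc q \<le> (N + (x - 1 - a)) div x"
      unfolding image_iff Bex_def lessThan_iff Suc_le_eq by blast
    then have "Suc q * x \<le> N + (x - 1 - a)"
      using assms by (simp add: less_eq_div_iff_mult_less_eq)
    with q assms show "t \<in> {t. t < N \<and> t mod x = a}"
      by (simp add: mult.commute)
  qed
  moreover have "inj_on (\<lambda>q. a + x * q) {..<(N + (x - 1 - a)) div x}"
    using assms by (auto simp: inj_on_def)
  ultimately show ?thesis
    by (simp add: card_image)
qed

text \<open>The quotient \<open>p\<close> that counts the class satisfies
  \<open>N - x < p * x < N + x\<close>, hence lies at distance less than 1 from
  \<open>N / x\<close>. In both constructions the degrees in \<open>U\<close> are such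
  counts.\<close>

lemma card_residue_class_floor_ceiling:
  fixes a x N :: nat
  assumes "a < x"
  shows "int (card {t. t < N \<and> t mod x = a}) \<in> {\<lfloor>real N / real x\<rfloor>, \<lceil>real N / real x\<rceil>}"
proof (rule mem_floor_ceiling_if_abs_diff_less_1)
  define p where "p = (N + (x - 1 - a)) div x"
  have "p * x \<le> N + (x - 1 - a)"
    unfolding p_def by (rule div_times_less_eq_dividend)
  then have up: "p * x < N + x"
    using assms by linarith
  have "N + (x - 1 - a) < p * x + x"
    unfolding p_def using assms
    by (metis add.commute dividend_less_div_times less_nat_zero_code not_gr_zero)
  then have lo: "N < p * x + x"
    by linarith
  have "real p * real x < real N + real x" "real N < real p * real x + real x"
    using up lo by (simp_all flip: of_nat_mult of_nat_add)
  then have "\<bar>real p - real N / real x\<bar> < 1"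
    using assms by (simp add: abs_less_iff field_simps)
  then show "\<bar>of_int (int (card {t. t < N \<and> t mod x = a})) - real N / real x\<bar> < 1"
    by (simp add: card_residue_class[OF assms] p_def)
qed

section \<open>From neighbourhoods violating Hall's condition to a graph\<close>

text \<open>A perfect matching after deleting \<open>S\<close> would inject \<open>J\<close> into
  its neighbours outside \<open>S\<close>, which are too few. \<open>N j\<close> is the
  neighbourhood of the \<open>j\<close>-th vertex of \<open>V\<close>; that vertex is encoded as
  \<open>n + j\<close>, which keeps the classes disjoint. The set \<open>A\<close> is left open so
  that each construction can insert its own floor and ceiling.\<close>

lemma noncritical_graph_if_Hall_violated:
  fixes n m k l :: nat and N :: "nat \<Rightarrow> nat set" and A :: "int set"
  assumes N: "\<And>j. j < m \<Longrightarrow> N j \<subseteq> {..<n}" "\<And>j. j < m \<Longrightarrow> card (N j) = l"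
    and A: "\<And>u. u < n \<Longrightarrow> int (card {j. j < m \<and> u \<in> N j}) \<in> A"
    and S: "S \<subseteq> {..<n}" "card S = k"
    and J: "J \<subseteq> {..<m}" "card ((\<Union>j\<in>J. N j) - S) < card J"
  shows "\<exists>(U :: nat set) (V :: nat set) (E :: nat set set).
           bipartite_graph U V E \<and> card U = n \<and> card V = m \<and>
           (\<forall>u\<in>U. int (degree E u) \<in> A) \<and> (\<forall>v\<in>V. degree E v = l) \<and>
           \<not> critical_bipartite k U V E"
proof -
  define E where "E = {{u, n + j} | u j. j < m \<and> u \<in> N j}"
  have less_n: "u < n" if "j < m" "u \<in> N j" for u j
    using N(1) that by blast
  have bip: "bipartite_graph {..<n} {n..<n + m} E"
    unfolding bipartite_graph_def
  proof (intro conjI subsetI)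
    fix e assume "e \<in> E"
    then obtain u j where "e = {u, n + j}" "j < m" "u \<in> N j"
      unfolding E_def by blast
    then show "e \<in> {{u, v} | u v. u \<in> {..<n} \<and> v \<in> {n..<n + m}}"
      using less_n by (intro CollectI exI[of _ u] exI[of _ "n + j"]) auto
  qed auto
  have degU: "int (degree E u) \<in> A" if "u < n" for u
  proof -
    have "{e \<in> E. u \<in> e} = (\<lambda>j. {u, n + j}) ` {j. j < m \<and> u \<in> N j}"
      using that unfolding E_def by auto
    moreover have "inj_on (\<lambda>j. {u, n + j}) {j. j < m \<and> u \<in> N j}"
      using that by (auto simp: inj_on_def doubleton_eq_iff)
    ultimately show ?thesis
      using A[OF that] by (simp add: degree_def card_image)
  qed
  have degV: "degree E v = l" if "v \<in> {n..<n + m}" for v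
  proof -
    obtain j where j: "v = n + j" "j < m"
      using \<open>v \<in> {n..<n + m}\<close> by (metis atLeastLessThan_iff le_Suc_ex nat_add_left_cancel_less)
    have "{e \<in> E. v \<in> e} = (\<lambda>u. {u, v}) ` N j"
      using j less_n unfolding E_def by fastforce
    moreover have "inj_on (\<lambda>u. {u, v}) (N j)"
      by (auto simp: inj_on_def doubleton_eq_iff)
    ultimately show ?thesis
      using N(2)[OF j(2)] by (simp add: degree_def card_image)
  qed
  have "\<not> has_perfect_matching (({..<n} - S) \<union> {n..<n + m}) (delete_vertices E S)"
  proof
    assume "has_perfect_matching (({..<n} - S) \<union> {n..<n + m}) (delete_vertices E S)"
    then obtain M where M: "matching (delete_vertices E S) M"
      and cover: "\<Union> M = ({..<n} - S) \<union> {n..<n + m}"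
      unfolding has_perfect_matching_def by auto
    from M have sub: "M \<subseteq> delete_vertices E S"
      and disj: "\<And>e f. e \<in> M \<Longrightarrow> f \<in> M \<Longrightarrow> e \<noteq> f \<Longrightarrow> e \<inter> f = {}"
      unfolding matching_def by simp_all
    have "\<exists>u. {u, n + j} \<in> M \<and> u \<in> N j - S" if "j \<in> J" for j
    proof -
      have "n + j \<in> \<Union> M"
        using cover J(1) that by auto
      then obtain e where e: "e \<in> M" "n + j \<in> e" by blast
      with sub have eE: "e \<in> E" "e \<inter> S = {}"
        unfolding delete_vertices_def by auto
      then obtain u i where ui: "e = {u, n + i}" "i < m" "u \<in> N i"
        unfolding E_def by blast
      \<comment> \<open>Since \<open>u < n\<close>, the end \<open>n + j\<close> of \<open>e\<close>
        can only be \<open>n + i\<close>.\<close>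
      with e less_n[of i u] have "i = j" by auto
      with e eE ui show ?thesis by auto
    qed
    then obtain f where f: "\<And>j. j \<in> J \<Longrightarrow> {f j, n + j} \<in> M \<and> f j \<in> N j - S"
      by metis
    \<comment> \<open>Two matching edges that share the end \<open>f i = f j\<close> coincide, and
      so do their ends in \<open>V\<close>.\<close>
    have "inj_on f J"
    proof (rule inj_onI)
      fix i j assume ij: "i \<in> J" "j \<in> J" "f i = f j"
      then have "{f i, n + i} = {f j, n + j}"
        using f disj by (metis disjoint_iff insertI1)
      with ij show "i = j"
        by (auto simp: doubleton_eq_iff)
    qed
    moreover have "f ` J \<subseteq> (\<Union>j\<in>J. N j) - S"
      using f by (intro image_subsetI) auto
    moreover have "finite ((\<Union>j\<in>J. N j) - S)"
    proof (rule finite_subset)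
      show "(\<Union>j\<in>J. N j) - S \<subseteq> {..<n}"
      proof
        fix u assume "u \<in> (\<Union>j\<in>J. N j) - S"
        then obtain j where "j \<in> J" "u \<in> N j" by blast
        with J(1) have "u < n" by (intro less_n[of j]) auto
        then show "u \<in> {..<n}" by simp
      qed
    qed simp
    ultimately have "card J \<le> card ((\<Union>j\<in>J. N j) - S)"
      by (rule card_inj_on_le)
    with J(2) show False by simp
  qed
  with S have "\<not> critical_bipartite k {..<n} {n..<n + m} E"
    unfolding critical_bipartite_def by blast
  with bip degU degV show ?thesis
    by (intro exI[of _ "{..<n}"] exI[of _ "{n..<n + m}"] exI[of _ E]) auto
qed

section \<open>Case (i): disjoint copies with cyclic intervals\<close>

text \<open>Congruent elements differ by a multiple of \<open>x\<close>, but their distance is below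
  \<open>x\<close>. Thus an interval wrapped around the cycle does not meet itself.\<close>

lemma inj_on_mod_interval:
  fixes b x :: nat
  assumes "l \<le> x"
  shows "inj_on (\<lambda>t. t mod x) {b..<b + l}"
proof (rule linorder_inj_onI)
  fix s t assume st: "s < t" "s \<in> {b..<b + l}" "t \<in> {b..<b + l}"
  show "s mod x \<noteq> t mod x"
  proof
    assume "s mod x = t mod x"
    then have "x dvd t - s"
      using st by (metis less_imp_le mod_eq_dvd_iff_nat)
    moreover have "0 < t - s" "t - s < x"
      using st assms by auto
    ultimately show False
      by (simp add: nat_dvd_not_less)
  qed
qed auto

lemma noncritical_graph_of_copies:
  fixes c x y k :: nat
  assumes c: "c > 1" and kx: "k + 1 \<le> x" and k: "c * x = c * y + k" "k > 0"
  shows "\<exists>(U :: nat set) (V :: nat set) (E :: nat set set).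
           bipartite_graph U V E \<and> card U = c * x \<and> card V = c * y \<and>
           (\<forall>u\<in>U. int (degree E u) \<in>
              {\<lfloor>real (y * (k + 1)) / real x\<rfloor>, \<lceil>real (y * (k + 1)) / real x\<rceil>}) \<and>
           (\<forall>v\<in>V. degree E v = k + 1) \<and> \<not> critical_bipartite k U V E"
proof -
  \<comment> \<open>The blocks \<open>I b\<close> with \<open>b < y\<close> tile the numbers below
    \<open>y * (k + 1)\<close>. On both sides, \<open>r + c * q\<close> encodes vertex
    \<open>q\<close> of copy \<open>r\<close>; in each copy, block \<open>b\<close> reduced modulo
    \<open>x\<close> is the neighbourhood of vertex \<open>b\<close> of \<open>V\<close>.\<close>
  define I where "I b = {b * (k + 1)..<b * (k + 1) + (k + 1)}" for b
  define N where "N j = (\<lambda>t. j mod c + c * (t mod x)) ` I (j div c)" for j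
  have mem_I: "t \<in> I b \<longleftrightarrow> t div (k + 1) = b" for t b
  proof -
    have "t div (k + 1) = b \<longleftrightarrow> b \<le> t div (k + 1) \<and> t div (k + 1) < Suc b"
      by auto
    also have "\<dots> \<longleftrightarrow> b * (k + 1) \<le> t \<and> t < Suc b * (k + 1)"
      by (simp only: less_eq_div_iff_mult_less_eq div_less_iff_less_mult)
    finally show ?thesis
      unfolding I_def by auto
  qed
  have less: "r + c * q < c * p" if "r < c" "q < p" for r q p
  proof -
    have "r + c * q < c * Suc q" using that by simp
    also have "\<dots> \<le> c * p" using that by (intro mult_le_mono2) simp
    finally show ?thesis .
  qed
  show ?thesis
  proof (rule noncritical_graph_if_Hall_violated)
    show "N j \<subseteq> {..<c * x}" for j
      unfolding N_def using c kx by (auto intro!: less)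
    show "card (N j) = k + 1" for j
    proof -
      have "inj_on (\<lambda>t. j mod c + c * (t mod x)) (I (j div c))"
        using inj_on_mod_interval[OF kx, of "j div c * (k + 1)"] c
        unfolding I_def inj_on_def by auto
      then show ?thesis
        unfolding N_def by (simp add: card_image I_def)
    qed
    show "int (card {j. j < c * y \<and> u \<in> N j}) \<in>
            {\<lfloor>real (y * (k + 1)) / real x\<rfloor>, \<lceil>real (y * (k + 1)) / real x\<rceil>}" if u: "u < c * x" for u
    proof -
      \<comment> \<open>Each \<open>t\<close> in \<open>T\<close> stands for one edge at
        \<open>u\<close>: it wraps onto the position of \<open>u\<close>, and \<open>g\<close> sends
        it to the vertex of \<open>V\<close> that owns its block, in the copy of \<open>u\<close>.
        So the degree of \<open>u\<close> is the size of a residue class.\<close>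
      define T where "T = {t. t < y * (k + 1) \<and> t mod x = u div c}"
      define g where "g t = u mod c + c * (t div (k + 1))" for t
      have "{j. j < c * y \<and> u \<in> N j} = g ` T"
      proof (intro equalityI subsetI)
        fix j assume "j \<in> {j. j < c * y \<and> u \<in> N j}"
        then obtain t where t: "j < c * y" "t div (k + 1) = j div c" "u = j mod c + c * (t mod x)"
          unfolding N_def by (auto simp: mem_I)
        then have "u mod c = j mod c" "u div c = t mod x"
          using c by auto
        moreover have "j div c < y"
          using t(1) c by (simp add: less_mult_imp_div_less mult.commute)
        then have "t < y * (k + 1)"
          using t(2) div_less_iff_less_mult[of "k + 1" t y] by simp
        ultimately have "g t = j" "t \<in> T"
          unfolding g_def T_def t(2) by simp_all
        then show "j \<in> g ` T" by blast
      next
        fix j assume "j \<in> g ` T"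
        then obtain t where t: "t < y * (k + 1)" "t mod x = u div c"
          "j = u mod c + c * (t div (k + 1))"
          unfolding g_def T_def by auto
        then have "j mod c = u mod c" "j div c = t div (k + 1)"
          using c by auto
        moreover have "j < c * y"
          unfolding t(3) using c t(1) by (intro less) (auto simp: less_mult_imp_div_less)
        moreover from calculation have "t \<in> I (j div c)" "u = j mod c + c * (t mod x)"
          using t(2) by (simp_all add: mem_I)
        ultimately show "j \<in> {j. j < c * y \<and> u \<in> N j}"
          unfolding N_def by blast
      qed
      \<comment> \<open>Equal values of \<open>g\<close> mean the same block, and a block of length
        \<open>k + 1 \<le> x\<close> meets each residue at most once.\<close>
      moreover have "inj_on g T"
      proof (rule inj_onI)
        fix s t assume st: "s \<in> T" "t \<in> T" "g s = g t"
        then have "s div (k + 1) = t div (k + 1)"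
          using c unfolding g_def by auto
        then have "s \<in> I (t div (k + 1))" "t \<in> I (t div (k + 1))"
          by (simp_all add: mem_I)
        with st show "s = t"
          using inj_on_mod_interval[OF kx, of "t div (k + 1) * (k + 1)"]
          unfolding I_def T_def inj_on_def by auto
      qed
      moreover have "u div c < x"
        using u by (simp add: less_mult_imp_div_less mult.commute)
      ultimately show ?thesis
        using card_residue_class_floor_ceiling[of "u div c" x "y * (k + 1)"]
        by (simp add: card_image T_def)
    qed
    have inj: "inj_on ((*) c) B" for B
      using c by (auto simp: inj_on_def)
    \<comment> \<open>The multiples of \<open>c\<close> form copy 0: \<open>S\<close> consists of
      its first \<open>k\<close> vertices in \<open>U\<close>, and \<open>J\<close> of all its
      \<open>y\<close> vertices in \<open>V\<close>.\<close>
    show "(*) c ` {..<k} \<subseteq> {..<c * x}"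
      using c kx by auto
    show "card ((*) c ` {..<k}) = k"
      by (simp add: card_image[OF inj])
    show "(*) c ` {..<y} \<subseteq> {..<c * y}"
      using c by auto
    have "(\<Union>j\<in>(*) c ` {..<y}. N j) - (*) c ` {..<k} \<subseteq> (*) c ` {k..<x}"
    proof
      fix u assume u: "u \<in> (\<Union>j\<in>(*) c ` {..<y}. N j) - (*) c ` {..<k}"
      then obtain t where t: "u = c * (t mod x)"
        unfolding N_def by auto
      with u have "t mod x \<notin> {..<k}" by blast
      with kx have "t mod x \<in> {k..<x}" by simp
      with t show "u \<in> (*) c ` {k..<x}" by blast
    qed
    then have "card ((\<Union>j\<in>(*) c ` {..<y}. N j) - (*) c ` {..<k}) \<le> card ((*) c ` {k..<x})"
      by (intro card_mono) auto
    also have "\<dots> = x - k"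
      by (simp add: card_image[OF inj])
    \<comment> \<open>From \<open>k = c * (x - y)\<close> with \<open>c > 1\<close> and
      \<open>x > y\<close> follows \<open>x - y < k\<close>; as \<open>k < x\<close>, the
      subtraction \<open>x - k\<close> is not truncated.\<close>
    also have "\<dots> < y"
    proof -
      have "x > y"
        using k c by (metis less_add_same_cancel1 nat_mult_less_cancel_disj)
      moreover have "c * (x - y) = k"
        using k by (simp add: diff_mult_distrib2)
      ultimately have "x - y < k"
        using c \<open>x > y\<close> n_less_m_mult_n[of "x - y" c] by simp
      then show ?thesis
        using kx by linarith
    qed
    finally show "card ((\<Union>j\<in>(*) c ` {..<y}. N j) - (*) c ` {..<k}) < card ((*) c ` {..<y})"
      by (simp add: card_image[OF inj])
  qed
qed

section \<open>Case (ii): blocks as residue classes modulo \<open>d\<close>\<close>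

text \<open>The blocks are the residue classes modulo \<open>d\<close> below
  \<open>d * (k + 1)\<close>, and vertex \<open>j\<close> of \<open>V\<close> is joined to the class
  of \<open>j\<close>. The degree of \<open>u\<close> then counts the \<open>j < m\<close> congruent
  to \<open>u\<close>. As \<open>d < m\<close>, both 0 and \<open>d\<close> index vertices of
  \<open>V\<close>, and they share class 0.\<close>

lemma noncritical_graph_of_blocks:
  fixes d m k :: nat
  assumes d: "d > 0" "d < m"
  shows "\<exists>(U :: nat set) (V :: nat set) (E :: nat set set).
           bipartite_graph U V E \<and> card U = d * (k + 1) \<and> card V = m \<and>
           (\<forall>u\<in>U. int (degree E u) \<in> {\<lfloor>real m / real d\<rfloor>, \<lceil>real m / real d\<rceil>}) \<and>
           (\<forall>v\<in>V. degree E v = k + 1) \<and> \<not> critical_bipartite k U V E"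
proof -
  define N where "N j = (\<lambda>s. j mod d + d * s) ` {..k}" for j
  show ?thesis
  proof (rule noncritical_graph_if_Hall_violated)
    have mem_N: "u \<in> N j \<longleftrightarrow> u < d * (k + 1) \<and> j mod d = u mod d" for u j
    proof
      assume "u \<in> N j"
      then obtain s where s: "s \<le> k" "u = j mod d + d * s"
        unfolding N_def by auto
      have "j mod d + d * s < d * Suc s" using d by simp
      also have "\<dots> \<le> d * (k + 1)" using s by (intro mult_le_mono2) simp
      finally show "u < d * (k + 1) \<and> j mod d = u mod d"
        using s by simp
    next
      assume u: "u < d * (k + 1) \<and> j mod d = u mod d"
      then have "u div d < k + 1"
        by (simp add: less_mult_imp_div_less mult.commute)
      with u show "u \<in> N j"
        unfolding N_def by (intro image_eqI[of _ _ "u div d"]) auto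
    qed
    show "N j \<subseteq> {..<d * (k + 1)}" for j
      using mem_N by auto
    show "card (N j) = k + 1" for j
      unfolding N_def using d by (subst card_image) (auto simp: inj_on_def)
    show "int (card {j. j < m \<and> u \<in> N j}) \<in> {\<lfloor>real m / real d\<rfloor>, \<lceil>real m / real d\<rceil>}"
      if "u < d * (k + 1)" for u
      using card_residue_class_floor_ceiling[of "u mod d" d m] that d by (simp add: mem_N)
    \<comment> \<open>Deleting all of class 0 except the vertex 0 leaves the two vertices in
      \<open>J = {0, d}\<close> with this single neighbour.\<close>
    show "(*) d ` {1..k} \<subseteq> {..<d * (k + 1)}"
      using d by (auto simp del: mult_Suc_right)
    show "card ((*) d ` {1..k}) = k"
      using d by (subst card_image) (auto simp: inj_on_def)
    show "{0, d} \<subseteq> {..<m}"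
      using d by auto
    have "(\<Union>j\<in>{0, d}. N j) - (*) d ` {1..k} \<subseteq> {0}"
    proof
      fix u assume u: "u \<in> (\<Union>j\<in>{0, d}. N j) - (*) d ` {1..k}"
      then obtain s where "s \<le> k" "u = d * s"
        unfolding N_def by auto
      with u have "s \<notin> {1..k}" by blast
      with \<open>s \<le> k\<close> have "s = 0" by simp
      with \<open>u = d * s\<close> show "u \<in> {0}" by simp
    qed
    then have "card ((\<Union>j\<in>{0, d}. N j) - (*) d ` {1..k}) \<le> card {0::nat}"
      by (intro card_mono) auto
    then show "card ((\<Union>j\<in>{0, d}. N j) - (*) d ` {1..k}) < card {0, d}"
      using d by simp
  qed
qed

section \<open>Reduction of the two alternatives to the constructions\<close>

theorem mainTheorem7:
  fixes n m k c x y :: nat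
  assumes "n > m" and "m > 1"
    and "k = n - m"
    and "c > 0" and "x > 0" and "y > 0"
    and "n = c * x" and "m = c * y"
    and "(c > 1 \<and> k + 1 \<le> x) \<or>
         (\<exists>d::real. d = real n / real (k + 1) \<and> d > 1 \<and> d \<in> \<int>)"
  shows "\<exists>(U :: nat set) (V :: nat set) (E :: nat set set).
           bipartite_graph U V E \<and> card U = n \<and> card V = m \<and>
           (\<forall>u\<in>U. int (degree E u) \<in>
              {\<lfloor>real (m * (k + 1)) / real n\<rfloor>, \<lceil>real (m * (k + 1)) / real n\<rceil>}) \<and>
           (\<forall>v\<in>V. degree E v = k + 1) \<and>
           \<not> critical_bipartite k U V E"
  using assms(9)
proof
  assume "c > 1 \<and> k + 1 \<le> x"
  moreover have "c * x = c * y + k" "k > 0"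
    using assms by auto
  \<comment> \<open>The factor \<open>c\<close> cancels, so the prescribed average degree is that of
    a single copy.\<close>
  moreover have "real (m * (k + 1)) / real n = real (y * (k + 1)) / real x"
  proof -
    have "real (m * (k + 1)) = real c * real (y * (k + 1))" "real n = real c * real x"
      using assms(7,8) by (simp_all add: algebra_simps)
    moreover have "real c \<noteq> 0"
      using assms(4) by simp
    ultimately show ?thesis
      by (simp only: mult_divide_mult_cancel_left not_False_eq_True)
  qed
  ultimately show ?thesis
    using noncritical_graph_of_copies[of c k x y] assms(7,8) by simp
next
  assume "\<exists>d::real. d = real n / real (k + 1) \<and> d > 1 \<and> d \<in> \<int>"
  then obtain e :: int where e: "real_of_int e = real n / real (k + 1)" "real_of_int e > 1"
    by (auto elim!: Ints_cases)
  define d where "d = nat e"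
  have "e > 1"
    using e(2) by simp
  then have "real d = real n / real (k + 1)" and d1: "d > 1"
    unfolding d_def e(1)[symmetric] by simp_all
  then have "real n = real (d * (k + 1))"
    by (simp add: field_simps)
  then have n: "n = d * (k + 1)"
    by (simp only: of_nat_eq_iff)
  have "k > 0"
    using assms(1,3) by simp
  \<comment> \<open>Both sides equal \<open>n\<close>; since \<open>d > 1\<close> and
    \<open>k > 0\<close> give \<open>d * k > k\<close>, the number of blocks is smaller than
    \<open>m\<close>.\<close>
  have "m + k = d * k + d"
    using n assms(1,3) by simp
  moreover have "d * k > k"
    using d1 \<open>k > 0\<close> by simp
  ultimately have "d < m"
    by linarith
  moreover have "real (m * (k + 1)) / real n = real m / real d"
  proof -
    have "real (k + 1) \<noteq> 0"
      by simp
    then show ?thesis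
      unfolding n of_nat_mult by (simp only: mult_divide_mult_cancel_right not_False_eq_True)
  qed
  ultimately show ?thesis
    using noncritical_graph_of_blocks[of d m k] d1 n by simp
qed

end
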